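(* Let $D$ and $G$ be two Seymour-tight orientations (with disjoint vertex sets). Suppose $X\subseteq V(G)$ satisfies $|N_1(G,X)|=|X|$. Let $H$ be the orientation on $V(D)\cup V(G)$ with arc set $E(D)\cup E(G)$ together with all arcs $u\to x$ where $u\in V(D)$ and $x\in X$. Then $H$ is a Seymour-tight orientation. In particular, one can take $X=N_1(G,x)$ for any $x\in V(G)$.
   Context: All directed graphs are finite, with non-empty vertex set, and without loops or multiple arcs. An orientation is a directed graph with no directed cycle of length 2. For a directed graph $G$ and $v\in V(G)$, $N_1(G,v)=\{w : (v,w)\in E(G)\}$ and $N_2(G,v)=\{w\in V(G)\setminus(N_1(G,v)\cup\{v\}) : \exists u\in N_1(G,v),\ (u,w)\in E(G)\}$. An orientation $G$ is Seymour-tight if $|N_1(G,v)|=|N_2(G,v)|$ for all $v\in V(G)$. For a set $X\subseteq V(G)$, $N_1(G,X)=\left(\bigcup_{x\in X}N_1(G,x)\right)\setminus X$ is the set of vertices outside $X$ that are out-neighbours of some vertex of $X$. *)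

theory Defs
  imports "Graph_Theory.Pair_Digraph"
begin

text \<open>
  The locale \<^locale>\<open>pair_digraph\<close> describes finite digraphs without loops; since arcs are
  pairs of vertices, there are no multiple arcs. It allows the null graph, which is
  excluded here.
\<close>
definition orientation :: "'a pair_pre_digraph \<Rightarrow> bool" where
  "orientation G \<longleftrightarrow> pair_digraph G \<and> pverts G \<noteq> {} \<and>
     (\<forall>u v. \<not> ((u, v) \<in> parcs G \<and> (v, u) \<in> parcs G))"

definition N1 :: "'a pair_pre_digraph \<Rightarrow> 'a \<Rightarrow> 'a set" where
  "N1 G v = {w. (v, w) \<in> parcs G}"

definition N2 :: "'a pair_pre_digraph \<Rightarrow> 'a \<Rightarrow> 'a set" where
  "N2 G v = {w \<in> pverts G - (N1 G v \<union> {v}). \<exists>u \<in> N1 G v. (u, w) \<in> parcs G}"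

definition N1_set :: "'a pair_pre_digraph \<Rightarrow> 'a set \<Rightarrow> 'a set" where
  "N1_set G X = (\<Union>x\<in>X. N1 G x) - X"

definition seymour_tight_orientation :: "'a pair_pre_digraph \<Rightarrow> bool" where
  "seymour_tight_orientation G \<longleftrightarrow>
     orientation G \<and> (\<forall>v \<in> pverts G. card (N1 G v) = card (N2 G v))"

definition join_onto ::
  "'a pair_pre_digraph \<Rightarrow> 'a pair_pre_digraph \<Rightarrow> 'a set \<Rightarrow> 'a pair_pre_digraph" where
  "join_onto D G X =
     \<lparr> pverts = pverts D \<union> pverts G,
       parcs = parcs D \<union> parcs G \<union> pverts D \<times> X \<rparr>"

end

theory Submission
  imports Defs
begin

text \<open>All new arcs run from \<open>D\<close> to \<open>G\<close>, so they create no directed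
  2-cycle and vertices of \<open>G\<close> keep their first and second out-neighbourhoods. A vertex
  \<open>v\<close> of \<open>D\<close> gains exactly \<open>X\<close> as first out-neighbours and,
  through \<open>X\<close>, exactly \<open>N1_set G X\<close> as second ones. These two gains lie in
  \<open>G\<close>, hence are disjoint from what \<open>v\<close> had in \<open>D\<close>, and they
  have equal size, so tightness at \<open>v\<close> survives
  (\<open>seymour_tight_join_onto\<close>). For \<open>X = N1 G x\<close> the size condition is
  tightness of \<open>G\<close> at \<open>x\<close>, by \<open>N1_set_N1\<close>.\<close>

lemma orientation_iff:
  "orientation G \<longleftrightarrow> finite (pverts G) \<and> pverts G \<noteq> {} \<and>
     parcs G \<subseteq> pverts G \<times> pverts G \<and> (\<forall>u v. (u, v) \<in> parcs G \<longrightarrow> (v, u) \<notin> parcs G)"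
proof
  assume G: "orientation G"
  then interpret pair_digraph G by (simp add: orientation_def)
  have "parcs G \<subseteq> pverts G \<times> pverts G" using in_arcsD1 in_arcsD2 by auto
  with G show "finite (pverts G) \<and> pverts G \<noteq> {} \<and>
     parcs G \<subseteq> pverts G \<times> pverts G \<and> (\<forall>u v. (u, v) \<in> parcs G \<longrightarrow> (v, u) \<notin> parcs G)"
    using pair_finite_verts unfolding orientation_def by blast
next
  assume G: "finite (pverts G) \<and> pverts G \<noteq> {} \<and>
     parcs G \<subseteq> pverts G \<times> pverts G \<and> (\<forall>u v. (u, v) \<in> parcs G \<longrightarrow> (v, u) \<notin> parcs G)"
  have "pair_digraph G"
  proof
    show "finite (parcs G)" using G by (blast intro: finite_subset)
    \<comment> \<open>A loop would be its own reversal, so the asymmetry clause with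
      \<open>u = v\<close> also rules out loops.\<close>
    show "fst e \<in> pverts G" "snd e \<in> pverts G" "fst e \<noteq> snd e" if "e \<in> parcs G" for e
      using G that by (cases e; auto)+
  qed (use G in blast)
  with G show "orientation G" unfolding orientation_def by blast
qed

lemma N1_subset_verts: "orientation G \<Longrightarrow> N1 G v \<subseteq> pverts G"
  unfolding orientation_iff N1_def by blast

text \<open>The two sides could differ only at \<open>x\<close>, which \<open>N2\<close> removes
  explicitly. On the left \<open>x\<close> cannot occur either: an arc from an out-neighbour of
  \<open>x\<close> back to \<open>x\<close> would close a 2-cycle.\<close>

lemma N1_set_N1: "orientation G \<Longrightarrow> N1_set G (N1 G x) = N2 G x"
  unfolding orientation_iff N1_set_def N2_def N1_def by blast

text \<open>The reversal of a new arc would lead from \<open>G\<close> to \<open>D\<close>, and no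
  arc does.\<close>

lemma orientation_join_onto:
  assumes "orientation D" "orientation G" "pverts D \<inter> pverts G = {}" "X \<subseteq> pverts G"
  shows "orientation (join_onto D G X)"
  unfolding orientation_iff
proof (intro conjI allI impI)
  show "(v, u) \<notin> parcs (join_onto D G X)" if "(u, v) \<in> parcs (join_onto D G X)" for u v
    using assms that unfolding orientation_iff by (simp add: join_onto_def) blast
qed (use assms in \<open>auto simp: orientation_iff join_onto_def\<close>)

lemma seymour_tight_join_onto:
  assumes tD: "seymour_tight_orientation D" and tG: "seymour_tight_orientation G"
    and disj: "pverts D \<inter> pverts G = {}" and X: "X \<subseteq> pverts G"
    and card_X: "card (N1_set G X) = card X"
  shows "seymour_tight_orientation (join_onto D G X)"
proof -
  let ?H = "join_onto D G X"
  have D: "orientation D" and G: "orientation G"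
    using tD tG by (auto simp: seymour_tight_orientation_def)
  have fin: "finite (pverts D)" "finite (pverts G)"
    and arcs: "parcs D \<subseteq> pverts D \<times> pverts D" "parcs G \<subseteq> pverts G \<times> pverts G"
    using D G by (auto simp: orientation_iff)
  have "card (N1 ?H v) = card (N2 ?H v)" if v: "v \<in> pverts ?H" for v
  proof (cases "v \<in> pverts D")
    case True
    then have vG: "v \<notin> pverts G" using disj by auto
    have N1: "N1 ?H v = N1 D v \<union> X"
      using True vG arcs by (auto simp: N1_def join_onto_def)
    \<comment> \<open>Two-step walks through \<open>N1 D v\<close> stay in \<open>D\<close> or end
      in \<open>X\<close>, whose vertices are already first out-neighbours. Walks through
      \<open>X\<close> stay in \<open>G\<close>, and removing \<open>X\<close> from their endpoints
      leaves \<open>N1_set G X\<close>.\<close>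
    have N2: "N2 ?H v = N2 D v \<union> N1_set G X"
      using X disj True vG arcs unfolding N2_def N1 N1_set_def
      by (simp add: N1_def join_onto_def) blast
    have sub: "N1 D v \<subseteq> pverts D" "N2 D v \<subseteq> pverts D" "N1_set G X \<subseteq> pverts G"
      using N1_subset_verts[OF D] N1_subset_verts[OF G] by (auto simp: N2_def N1_set_def)
    have "card (N1 ?H v) = card (N1 D v) + card X"
      unfolding N1 using sub X disj fin
      by (intro card_Un_disjoint) (auto intro: finite_subset)
    also have "\<dots> = card (N2 D v) + card (N1_set G X)"
      using tD True card_X by (simp add: seymour_tight_orientation_def)
    also have "\<dots> = card (N2 ?H v)"
      unfolding N2 using sub disj fin
      by (intro card_Un_disjoint[symmetric]) (auto intro: finite_subset)
    finally show ?thesis .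
  next
    case False
    then have vG: "v \<in> pverts G" using v by (simp add: join_onto_def)
    have N1: "N1 ?H v = N1 G v"
      using False arcs by (auto simp: N1_def join_onto_def)
    \<comment> \<open>The out-neighbours of \<open>v\<close> lie in \<open>G\<close>, so they too
      have gained no out-arcs.\<close>
    have "N2 ?H v = N2 G v"
      unfolding N2_def N1 using disj vG arcs by (simp add: N1_def join_onto_def) blast
    with N1 tG vG show ?thesis by (simp add: seymour_tight_orientation_def)
  qed
  then show ?thesis
    using orientation_join_onto[OF D G disj X] by (simp add: seymour_tight_orientation_def)
qed

theorem lemma5p1:
  fixes D G :: "'a pair_pre_digraph"
  assumes "seymour_tight_orientation D"
    and "seymour_tight_orientation G"
    and "pverts D \<inter> pverts G = {}"
  shows "(\<forall>X. X \<subseteq> pverts G \<and> card (N1_set G X) = card X \<longrightarrow>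
            seymour_tight_orientation (join_onto D G X)) \<and>
         (\<forall>x \<in> pverts G. N1 G x \<subseteq> pverts G \<and>
            card (N1_set G (N1 G x)) = card (N1 G x) \<and>
            seymour_tight_orientation (join_onto D G (N1 G x)))"
proof (intro conjI allI impI ballI; (elim conjE)?)
  fix X assume "X \<subseteq> pverts G" "card (N1_set G X) = card X"
  then show "seymour_tight_orientation (join_onto D G X)"
    using seymour_tight_join_onto assms by blast
next
  have G: "orientation G" using assms(2) by (simp add: seymour_tight_orientation_def)
  fix x assume x: "x \<in> pverts G"
  show sub: "N1 G x \<subseteq> pverts G" using N1_subset_verts[OF G] .
  show card_eq: "card (N1_set G (N1 G x)) = card (N1 G x)"
    using assms(2) x by (simp add: N1_set_N1[OF G] seymour_tight_orientation_def)
  show "seymour_tight_orientation (join_onto D G (N1 G x))"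
    using seymour_tight_join_onto[OF assms sub card_eq] .
qed

end
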